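(* For all real $b,c>1$, \[ \dim_H E(b,c)=\dim_H\widetilde{E}(b,c)=\frac{1}{1+b^2}, \] where $E(b,c)=\{x\in I_{even}\colon a_{2n}(x)\ge c^{b^{2n}}\text{ for infinitely many } n\}$ and $\widetilde{E}(b,c)=\{x\in I_{even}\colon a_{2n}(x)\ge c^{b^{2n}}\text{ for all } n\ge1\}$.
   Context: Every $x\in[0,1)$ has a regular continued fraction expansion $x=[0;a_1(x),a_2(x),\ldots]$. $I_{even}$ is the set of $x\in[0,1)$ whose partial quotients satisfy $a_{2k+1}(x)=1$ for all $k\ge0$. $\dim_H$ denotes Hausdorff dimension. *)

theory Defs
  imports "HOL-Analysis.Analysis"
begin

section \<open>Hausdorff measure and dimension\<close>

text \<open>
  The convention for \<open>s = 0\<close> is that every nonempty set has weight 1, so that the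
  zero-dimensional Hausdorff measure is counting measure (note \<open>0 powr 0 = 0\<close>).
\<close>

definition hausdorff_weight :: "real \<Rightarrow> 'a::metric_space set \<Rightarrow> ennreal" where
  "hausdorff_weight s U =
     (if U = {} then 0 else if s = 0 then 1 else ennreal (diameter U powr s))"

text \<open>
  Boundedness is required explicitly because \<open>diameter\<close> is only meaningful on bounded sets.
  Finite covers are included, since members of the sequence may be empty.
\<close>

definition hausdorff_covers :: "real \<Rightarrow> 'a::metric_space set \<Rightarrow> (nat \<Rightarrow> 'a set) set" where
  "hausdorff_covers \<delta> A =
     {U. A \<subseteq> (\<Union>i. U i) \<and> (\<forall>i. bounded (U i) \<and> diameter (U i) \<le> \<delta>)}"

definition hausdorff_premeasure :: "real \<Rightarrow> real \<Rightarrow> 'a::metric_space set \<Rightarrow> ennreal" where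
  "hausdorff_premeasure s \<delta> A =
     (INF U \<in> hausdorff_covers \<delta> A. \<Sum>i. hausdorff_weight s (U i))"

definition hausdorff_measure :: "real \<Rightarrow> 'a::metric_space set \<Rightarrow> ennreal" where
  "hausdorff_measure s A = (SUP \<delta> \<in> {0<..}. hausdorff_premeasure s \<delta> A)"

definition hausdorff_dim :: "'a::metric_space set \<Rightarrow> ereal" where
  "hausdorff_dim A = Inf (ereal ` {s. 0 \<le> s \<and> hausdorff_measure s A = 0})"

section \<open>Regular continued fractions on the unit interval\<close>

definition gauss_map :: "real \<Rightarrow> real" where
  "gauss_map x = frac (1 / x)"

text \<open>
  The partial quotients of \<open>x = [0; a\<^sub>1, a\<^sub>2, \<dots>]\<close> for \<open>x \<in> [0,1)\<close>.
  Since \<open>1 / 0 = 0\<close>, both the Gauss map and the partial quotients of a terminating expansion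
  are 0 from the termination on, whereas genuine partial quotients are at least 1.
\<close>

fun partial_quotient :: "nat \<Rightarrow> real \<Rightarrow> int" where
  "partial_quotient 0 x = \<lfloor>x\<rfloor>"
| "partial_quotient (Suc n) x = \<lfloor>1 / (gauss_map ^^ n) x\<rfloor>"

lemma gauss_map_range: "0 \<le> gauss_map x" "gauss_map x < 1"
  by (simp_all add: gauss_map_def frac_lt_1)

lemma partial_quotient_ge_1:
  assumes "0 \<le> x" "x < 1" "(gauss_map ^^ n) x \<noteq> 0"
  shows "1 \<le> partial_quotient (Suc n) x"
proof -
  have "0 \<le> (gauss_map ^^ n) x" "(gauss_map ^^ n) x < 1"
    using assms gauss_map_range by (cases n; simp)+
  with assms show ?thesis by (simp add: field_simps le_floor_iff)
qed

lemma continued_fraction_step: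
  assumes "(gauss_map ^^ n) x \<noteq> 0"
  shows "(gauss_map ^^ n) x = 1 / (partial_quotient (Suc n) x + (gauss_map ^^ Suc n) x)"
  by (simp add: gauss_map_def frac_def)

section \<open>The exceptional sets\<close>

definition I_even :: "real set" where
  "I_even = {x \<in> {0..<1}. \<forall>k. partial_quotient (2 * k + 1) x = 1}"

definition E_inf :: "real \<Rightarrow> real \<Rightarrow> real set" where
  "E_inf b c = {x \<in> I_even.
     infinite {n. n \<ge> 1 \<and> real_of_int (partial_quotient (2 * n) x) \<ge> c powr (b ^ (2 * n))}}"

definition E_all :: "real \<Rightarrow> real \<Rightarrow> real set" where
  "E_all b c = {x \<in> I_even.
     \<forall>n\<ge>1. real_of_int (partial_quotient (2 * n) x) \<ge> c powr (b ^ (2 * n))}"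

lemma I_even_nonterminating:
  assumes "x \<in> I_even"
  shows "(gauss_map ^^ n) x \<noteq> 0"
proof
  assume *: "(gauss_map ^^ n) x = 0"
  have "gauss_map 0 = 0"
    by (simp add: gauss_map_def)
  with * have "(gauss_map ^^ (n + m)) x = 0" for m
    by (induction m) simp_all
  from this[of n] have "partial_quotient (2 * n + 1) x = 0"
    by (simp add: mult_2)
  with assms show False by (simp add: I_even_def)
qed

end

(*
  A point of I_even with a_2 = m and tail y is 1 - 1/(m + 1 + y), so I_even is the limit set of an
  iterated function system with contraction ratios of order m^(-2). Put B = b^2, so that the n-th
  digit a_2n is compared with c^(B^n), and let Q be the product of the first n digits.

  Upper bound. Fix s > 1/(1 + B) and 1 < beta < B with s(1 + beta) > 1. For any D, a point of E(b,c)
  has infinitely many digits with m_(n+1) >= D^(n+1) Q^(beta-1): otherwise ln Q would be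
  o(B^n). Such a point lies in a piece of the cylinder of its first n digits of diameter at most
  D^(-n-1) Q^(-1-beta). The s-th powers of these diameters factor over the digits, so the sum over
  all words of length n is at most (Z D^(-s))^n with Z = sum m^(-s(1+beta)) finite; a large D makes
  this geometric. No truncation of the digits is needed although the sum of m^(-2s) diverges.

  Lower bound. Let M_n be the least integer not below c^(B^n), and send t in [0,1) with mixed radix
  digits d_n < M_n to the point of I_even with digits M_n + d_n. For s < 1/(1 + B) the inverse of
  this map is s-Hoelder, so Lebesgue measure bounds s-dimensional cover sums from below.
*)

theory Submission
  imports Defs "HOL-Real_Asymp.Real_Asymp"
begin

section \<open>The iterated function system of \<open>I_even\<close>\<close>

text \<open>
  A point of \<open>I_even\<close> with \<open>a\<^sub>2 = m\<close> and tail \<open>y = [0; a\<^sub>3, a\<^sub>4, \<dots>]\<close> is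
  \<open>1 / (1 + 1 / (m + y)) = 1 - 1 / (m + 1 + y)\<close>. Digits are indexed from 0:
  \<open>even_digit n\<close> is \<open>a\<^bsub>2n+2\<^esub>\<close>.
\<close>

definition even_branch :: "nat \<Rightarrow> real \<Rightarrow> real" where
  "even_branch m y = 1 - 1 / (real m + 1 + y)"

definition even_digit :: "nat \<Rightarrow> real \<Rightarrow> nat" where
  "even_digit n x = nat (partial_quotient (2 * n + 2) x)"

definition gauss2 :: "real \<Rightarrow> real" where
  "gauss2 x = gauss_map (gauss_map x)"

text \<open>The index on the right is a successor because \<open>partial_quotient 0\<close> is the
  integer part, which takes no part in the shift.\<close>

lemma partial_quotient_gauss2:
  "partial_quotient (Suc (Suc (Suc n))) x = partial_quotient (Suc n) (gauss2 x)"
  by (simp add: gauss2_def funpow_swap1)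

lemma even_digit_Suc: "even_digit (Suc n) x = even_digit n (gauss2 x)"
  using partial_quotient_gauss2[of "2 * n + 1" x] by (simp add: even_digit_def)

lemma even_digit_funpow: "even_digit n x = even_digit 0 ((gauss2 ^^ n) x)"
  by (induction n arbitrary: x) (simp_all add: even_digit_Suc funpow_swap1)

text \<open>\<open>y < 1\<close> makes \<open>m\<close> the floor of \<open>m + y\<close>, and
  \<open>0 < y\<close> keeps \<open>1 / (m + y)\<close> below 1 even for \<open>m = 1\<close>, so
  each of the two Gauss steps strips exactly the intended integer part.\<close>

lemma even_branch_dynamics:
  assumes "m \<ge> 1" "0 < y" "y < 1"
  shows "gauss2 (even_branch m y) = y"
    and "partial_quotient 1 (even_branch m y) = 1"
    and "even_digit 0 (even_branch m y) = m"
proof -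
  have m: "real m \<ge> 1" using assms by simp
  then have inv: "1 / even_branch m y = 1 + 1 / (real m + y)"
    using assms by (simp add: even_branch_def field_simps)
  have bounds: "0 < 1 / (real m + y)" "1 / (real m + y) < 1"
    using m assms by (auto simp: field_simps)
  show "partial_quotient 1 (even_branch m y) = 1"
    using bounds inv by (simp add: floor_eq_iff)
  have g: "gauss_map (even_branch m y) = 1 / (real m + y)"
    unfolding gauss_map_def inv using bounds by (simp add: frac_unique_iff)
  have f: "\<lfloor>real m + y\<rfloor> = int m" using assms by (simp add: floor_eq_iff)
  show "gauss2 (even_branch m y) = y"
    unfolding gauss2_def g using f by (simp add: gauss_map_def frac_def)
  show "even_digit 0 (even_branch m y) = m"
    using f g by (simp add: even_digit_def numeral_2_eq_2)
qed

lemma I_even_decomposition: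
  assumes "x \<in> I_even"
  shows "gauss2 x \<in> I_even" "even_digit 0 x \<ge> 1" "x = even_branch (even_digit 0 x) (gauss2 x)"
    and "partial_quotient 2 x = int (even_digit 0 x)"
proof -
  have x: "0 \<le> x" "x < 1" and pq1: "partial_quotient 1 x = 1"
    and pq: "\<And>k. partial_quotient (2 * k + 1) x = 1"
    using assms by (auto simp: I_even_def dest: spec[of _ 0])
  have "partial_quotient (2 * k + 1) (gauss2 x) = 1" for k
    using pq[of "Suc k"] partial_quotient_gauss2[of "2 * k" x] by simp
  then show "gauss2 x \<in> I_even"
    by (simp add: I_even_def gauss2_def gauss_map_range)
  \<comment> \<open>Non-termination excludes the default value of \<open>1 / 0\<close>. Both Gauss
    steps are then genuine continued fraction steps, and \<open>nat\<close> in
    \<open>even_digit\<close> truncates nothing.\<close>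
  have nz: "x \<noteq> 0" "gauss_map x \<noteq> 0"
    using I_even_nonterminating[OF assms, of 0] I_even_nonterminating[OF assms, of 1] by auto
  have ge: "1 \<le> partial_quotient 2 x"
    using partial_quotient_ge_1[OF x, of 1] nz by (simp add: numeral_2_eq_2)
  then show "even_digit 0 x \<ge> 1" "partial_quotient 2 x = int (even_digit 0 x)"
    by (simp_all add: even_digit_def numeral_2_eq_2 del: partial_quotient.simps)
  then have m: "real_of_int (partial_quotient 2 x) = real (even_digit 0 x)" by simp
  have "x = 1 / (1 + gauss_map x)"
    using continued_fraction_step[of 0 x] nz pq1 by simp
  moreover have "gauss_map x = 1 / (real (even_digit 0 x) + gauss2 x)"
    using continued_fraction_step[of 1 x] nz m by (simp add: numeral_2_eq_2 gauss2_def)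
  moreover have "gauss2 x \<ge> 0" by (simp add: gauss2_def gauss_map_range)
  ultimately show "x = even_branch (even_digit 0 x) (gauss2 x)"
    using \<open>even_digit 0 x \<ge> 1\<close> by (simp add: even_branch_def field_simps)
qed

lemma I_even_funpow:
  assumes "x \<in> I_even"
  shows "(gauss2 ^^ n) x \<in> I_even"
  using assms by (induction n) (auto intro: I_even_decomposition(1))

lemma partial_quotient_even:
  assumes "x \<in> I_even"
  shows "partial_quotient (2 * Suc n) x = int (even_digit n x)"
  using assms
proof (induction n arbitrary: x)
  case 0
  then show ?case using I_even_decomposition(4) by simp
next
  case (Suc n)
  show ?case
    using Suc.IH[OF I_even_decomposition(1)[OF Suc.prems]] partial_quotient_gauss2[of "2 * n + 1" x]
    by (simp add: even_digit_Suc)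
qed

lemma even_digit_ge_1:
  assumes "x \<in> I_even"
  shows "even_digit n x \<ge> 1"
  using I_even_decomposition(2)[OF I_even_funpow[OF assms]] by (metis even_digit_funpow)

text \<open>The extreme case is digit 1 with tail 0, where the branch equals 1/2. Consequently any
  two tails are less than 1/2 apart, which the separation estimate relies on.\<close>

lemma I_even_bounds:
  assumes "x \<in> I_even"
  shows "1 / 2 \<le> x" "x < 1"
proof -
  have "gauss2 x \<ge> 0" by (simp add: gauss2_def gauss_map_range)
  then have "1 / (real (even_digit 0 x) + 1 + gauss2 x) \<le> 1 / 2"
    using I_even_decomposition(2)[OF assms] by (intro divide_left_mono) auto
  then show "1 / 2 \<le> x"
    by (subst I_even_decomposition(3)[OF assms]) (simp add: even_branch_def)
  show "x < 1" using assms by (simp add: I_even_def)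
qed

lemma I_even_foldr:
  assumes "x \<in> I_even"
  shows "x = foldr even_branch (map (\<lambda>k. even_digit k x) [0..<n]) ((gauss2 ^^ n) x)"
  using assms
proof (induction n arbitrary: x)
  case (Suc n)
  have "[0..<Suc n] = 0 # map Suc [0..<n]" by (simp add: map_Suc_upt upt_conv_Cons del: upt_Suc)
  then show ?case
    using Suc.IH[OF I_even_decomposition(1)[OF Suc.prems]] I_even_decomposition(3)[OF Suc.prems]
    by (simp add: even_digit_Suc funpow_swap1 comp_def del: upt_Suc)
qed simp

text \<open>Two digits are treated at once: \<open>m = n\<close> yields the contraction ratio of one
  branch, \<open>m \<noteq> n\<close> the gap between two branches.\<close>

lemma even_branch_diff:
  assumes "0 \<le> u" "0 \<le> v"
  shows "\<bar>even_branch m u - even_branch n v\<bar>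
       = \<bar>(real m + u) - (real n + v)\<bar> / ((real m + 1 + u) * (real n + 1 + v))"
proof -
  have "even_branch m u - even_branch n v
      = ((real m + u) - (real n + v)) / ((real m + 1 + u) * (real n + 1 + v))"
    using assms by (simp add: even_branch_def field_simps)
  then show ?thesis using assms by (simp add: abs_mult)
qed

section \<open>Distortion of compositions of branches\<close>

lemma even_branch_range:
  assumes "0 \<le> y"
  shows "0 \<le> even_branch m y" "even_branch m y < 1"
  using assms by (auto simp: even_branch_def)

lemma foldr_even_branch_range:
  assumes "y \<in> {0..1}"
  shows "foldr even_branch p y \<in> {0..1}"
  using assms by (induction p) (auto simp: even_branch_range less_imp_le)

text \<open>Only \<open>m * m\<close> is kept of the denominator
  \<open>(m + 1 + u) * (m + 1 + v)\<close>. The ratios then multiply to the squared product of the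
  digits, the form in which cover sums factor over the letters.\<close>

lemma foldr_even_branch_contracts:
  assumes "\<forall>m\<in>set p. m \<ge> 1" "u \<in> {0..1}" "v \<in> {0..1}"
  shows "\<bar>foldr even_branch p u - foldr even_branch p v\<bar> \<le> \<bar>u - v\<bar> / (real (prod_list p))\<^sup>2"
  using assms(1)
proof (induction p)
  case (Cons m p)
  let ?u = "foldr even_branch p u" and ?v = "foldr even_branch p v"
  have uv: "0 \<le> ?u" "0 \<le> ?v"
    using foldr_even_branch_range assms(2,3) by auto
  have m: "real m \<ge> 1" using Cons.prems by simp
  have "\<bar>even_branch m ?u - even_branch m ?v\<bar> = \<bar>?u - ?v\<bar> / ((real m + 1 + ?u) * (real m + 1 + ?v))"
    using even_branch_diff[OF uv] by simp
  also have "\<dots> \<le> \<bar>?u - ?v\<bar> / (real m * real m)"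
    using m uv by (intro divide_left_mono mult_mono) auto
  also have "\<dots> \<le> \<bar>u - v\<bar> / (real (prod_list p))\<^sup>2 / (real m * real m)"
    using Cons by (intro divide_right_mono) auto
  finally show ?case by (simp add: power2_eq_square mult_ac)
qed simp

text \<open>Counterpart of the contraction bound: arguments in the unit interval give
  \<open>m + 1 + u \<le> m + 2\<close> for each factor of the denominator.\<close>

lemma foldr_even_branch_expands:
  assumes "u \<in> {0..1}" "v \<in> {0..1}"
  shows "\<bar>u - v\<bar> / (\<Prod>m\<leftarrow>p. real m + 2)\<^sup>2 \<le> \<bar>foldr even_branch p u - foldr even_branch p v\<bar>"
proof (induction p)
  case (Cons m p)
  let ?u = "foldr even_branch p u" and ?v = "foldr even_branch p v"
  have uv: "0 \<le> ?u" "0 \<le> ?v" "?u \<le> 1" "?v \<le> 1"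
    using foldr_even_branch_range assms by auto
  have "\<bar>u - v\<bar> / (\<Prod>m\<leftarrow>p. real m + 2)\<^sup>2 / ((real m + 2) * (real m + 2))
     \<le> \<bar>?u - ?v\<bar> / ((real m + 2) * (real m + 2))"
    using Cons by (intro divide_right_mono) auto
  also have "\<dots> \<le> \<bar>?u - ?v\<bar> / ((real m + 1 + ?u) * (real m + 1 + ?v))"
    using uv by (intro divide_left_mono mult_mono) (auto intro!: mult_pos_pos)
  also have "\<dots> = \<bar>even_branch m ?u - even_branch m ?v\<bar>"
    using even_branch_diff[OF uv(1,2)] by simp
  finally show ?case by (simp add: power2_eq_square mult_ac)
qed simp

text \<open>\<open>z k\<close> is the tail after \<open>k\<close> digits of the point to be
  constructed: the limit of the finite compositions that start at digit \<open>k\<close> and are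
  applied to 0. The branches are increasing, so these compositions increase with their length.
  Treating all \<open>k\<close> together lets the recursion pass to the limit by continuity.\<close>

lemma even_branch_fixed_sequence:
  fixes m :: "nat \<Rightarrow> nat"
  assumes "\<And>k. m k \<ge> 1"
  obtains z :: "nat \<Rightarrow> real" where "\<And>k. z k = even_branch (m k) (z (Suc k))" "\<And>k. 0 < z k \<and> z k < 1"
proof -
  define s where "s k n = foldr even_branch (map (\<lambda>i. m (k + i)) [0..<n]) 0" for k n
  have s_Suc: "s k (Suc n) = even_branch (m k) (s (Suc k) n)" for k n
  proof -
    have "[0..<Suc n] = 0 # map Suc [0..<n]" by (simp add: map_Suc_upt upt_conv_Cons del: upt_Suc)
    then show ?thesis by (simp add: s_def comp_def del: upt_Suc)
  qed
  have s_range: "0 \<le> s k n" "s k n \<le> 1" for k n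
    using foldr_even_branch_range[of 0] by (auto simp: s_def)
  have s_mono: "s k n \<le> s k (Suc n)" for k n
  proof (induction n arbitrary: k)
    case 0
    then show ?case by (simp add: s_def even_branch_range)
  next
    case (Suc n)
    have "1 / (real (m k) + 1 + s (Suc k) (Suc n)) \<le> 1 / (real (m k) + 1 + s (Suc k) n)"
      using Suc[of "Suc k"] s_range[of "Suc k" n]
      by (intro divide_left_mono) (auto intro!: mult_pos_pos)
    then show ?case by (simp only: s_Suc[of k] even_branch_def)
  qed
  define z where "z k = lim (s k)" for k
  have lim: "s k \<longlonglongrightarrow> z k" for k
  proof -
    have "incseq (s k)" using s_mono by (rule incseq_SucI)
    then obtain L where "s k \<longlonglongrightarrow> L"
      by (rule incseq_convergent[where B = 1]) (simp_all add: s_range)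
    then show ?thesis by (simp add: z_def limI)
  qed
  have z_range: "0 \<le> z k" for k
    using lim s_range by (intro LIMSEQ_le_const[OF lim]) auto
  have z_eq: "z k = even_branch (m k) (z (Suc k))" for k
  proof (rule LIMSEQ_unique)
    show "(\<lambda>n. s k (Suc n)) \<longlonglongrightarrow> z k" using lim by (rule LIMSEQ_Suc)
    show "(\<lambda>n. s k (Suc n)) \<longlonglongrightarrow> even_branch (m k) (z (Suc k))"
      unfolding s_Suc even_branch_def using z_range[of "Suc k"]
      by (intro tendsto_intros lim) auto
  qed
  have "0 < z k \<and> z k < 1" for k
    using z_range[of "Suc k"] assms[of k] by (subst (1 2) z_eq) (auto simp: even_branch_def)
  then show thesis using that z_eq by blast
qed

text \<open>The point is \<open>z 0\<close>: since \<open>gauss2\<close> undoes one branch, its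
  iterates run through the tails \<open>z k\<close>, where the quotients can be read off.\<close>

lemma I_even_with_digits:
  fixes m :: "nat \<Rightarrow> nat"
  assumes "\<And>k. m k \<ge> 1"
  shows "\<exists>x\<in>I_even. \<forall>k. even_digit k x = m k"
proof -
  obtain z where z: "\<And>k. z k = even_branch (m k) (z (Suc k))" "\<And>k. 0 < z k \<and> z k < 1"
    using even_branch_fixed_sequence[of m] assms by blast
  have step: "gauss2 (z k) = z (Suc k)" "partial_quotient 1 (z k) = 1" "even_digit 0 (z k) = m k" for k
    using even_branch_dynamics[of "m k" "z (Suc k)", folded z(1)] z(2)[of "Suc k"] assms[of k] by auto
  have pow: "(gauss2 ^^ k) (z 0) = z k" for k
    by (induction k) (simp_all add: step)
  have "partial_quotient (2 * k + 1) (z j) = 1" for k j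
  proof (induction k arbitrary: j)
    case (Suc k)
    then show ?case using partial_quotient_gauss2[of "2 * k" "z j"] step(1)[of j] by simp
  qed (use step in simp)
  then have "z 0 \<in> I_even" using z(2)[of 0] by (simp add: I_even_def)
  moreover have "even_digit k (z 0) = m k" for k
    using even_digit_funpow[of k "z 0"] pow step by simp
  ultimately show ?thesis by blast
qed

section \<open>Hausdorff measure and dimension\<close>

lemma hausdorff_premeasure_mono:
  "A \<subseteq> B \<Longrightarrow> hausdorff_premeasure s d A \<le> hausdorff_premeasure s d B"
  unfolding hausdorff_premeasure_def hausdorff_covers_def by (intro INF_superset_mono) auto

lemma hausdorff_measure_mono:
  "A \<subseteq> B \<Longrightarrow> hausdorff_measure s A \<le> hausdorff_measure s B"
  unfolding hausdorff_measure_def by (intro SUP_mono) (auto intro: hausdorff_premeasure_mono)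

lemma hausdorff_dim_mono:
  assumes "A \<subseteq> B"
  shows "hausdorff_dim A \<le> hausdorff_dim B"
proof -
  have "hausdorff_measure s A = 0" if "hausdorff_measure s B = 0" for s
    using hausdorff_measure_mono[OF assms, of s] that by simp
  then show ?thesis
    unfolding hausdorff_dim_def by (intro Inf_superset_mono image_mono) auto
qed

text \<open>\<open>0 \<le> d\<close> ensures that every \<open>d + e\<close> is among the
  nonnegative exponents over which the infimum is taken.\<close>

lemma hausdorff_dim_leI:
  assumes "0 \<le> d" "\<And>s. d < s \<Longrightarrow> hausdorff_measure s A = 0"
  shows "hausdorff_dim A \<le> ereal d"
proof (rule ereal_le_epsilon2)
  fix e :: real assume "0 < e"
  then have "ereal (d + e) \<in> ereal ` {s. 0 \<le> s \<and> hausdorff_measure s A = 0}"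
    using assms by auto
  then show "hausdorff_dim A \<le> ereal d + ereal e"
    unfolding hausdorff_dim_def by (simp add: Inf_lower)
qed

lemma hausdorff_dim_geI:
  assumes "\<And>s. 0 \<le> s \<Longrightarrow> s < d \<Longrightarrow> hausdorff_measure s A \<noteq> 0"
  shows "ereal d \<le> hausdorff_dim A"
proof -
  have "d \<le> s" if "0 \<le> s" "hausdorff_measure s A = 0" for s
    using assms[of s] that by (cases "d \<le> s") auto
  then show ?thesis
    unfolding hausdorff_dim_def by (intro Inf_greatest) auto
qed

section \<open>Covers indexed by words\<close>

lemma sum_weights_lists:
  fixes w :: "nat \<Rightarrow> real"
  assumes "finite S"
  shows "(\<Sum>p\<in>{p. set p \<subseteq> S \<and> length p = n}. \<Prod>m\<leftarrow>p. w m) = (\<Sum>m\<in>S. w m) ^ n"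
proof (induction n)
  case 0
  have "{p. set p \<subseteq> S \<and> length p = 0} = {[]}" by auto
  then show ?case by simp
next
  case (Suc n)
  let ?L = "\<lambda>n. {p. set p \<subseteq> S \<and> length p = n}"
  have "?L (Suc n) = (\<lambda>(m, p). m # p) ` (S \<times> ?L n)"
    by (auto simp: length_Suc_conv image_iff) 
  moreover have "inj_on (\<lambda>(m, p). m # p) (S \<times> ?L n)" by (auto simp: inj_on_def)
  ultimately have "(\<Sum>p\<in>?L (Suc n). \<Prod>m\<leftarrow>p. w m) = (\<Sum>(m, p)\<in>S \<times> ?L n. w m * (\<Prod>m\<leftarrow>p. w m))"
    by (simp add: sum.reindex case_prod_unfold)
  also have "\<dots> = (\<Sum>m\<in>S. w m) * (\<Sum>p\<in>?L n. \<Prod>m\<leftarrow>p. w m)"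
    by (simp add: sum_product sum.cartesian_product)
  finally show ?case using Suc by simp
qed

text \<open>Finitely many words use a finite alphabet and have bounded length. Grouped by length,
  all words over that alphabet contribute powers of a number at most 1/2, so a geometric tail
  remains.\<close>

lemma sum_weights_long_lists:
  fixes w :: "nat \<Rightarrow> real"
  assumes "\<And>m. 0 \<le> w m" "summable w" "suminf w \<le> 1 / 2" "finite F" "\<And>p. p \<in> F \<Longrightarrow> length p \<ge> N"
  shows "(\<Sum>p\<in>F. \<Prod>m\<leftarrow>p. w m) \<le> 2 * (1 / 2) ^ N"
proof -
  define S where "S = \<Union> (set ` F)"
  define M where "M = Suc (Max (length ` F))"
  have S: "finite S" using assms(4) by (simp add: S_def)
  have M: "length p < M" if "p \<in> F" for p
    using assms(4) that by (simp add: M_def le_imp_less_Suc)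
  let ?L = "\<lambda>n. {p. set p \<subseteq> S \<and> length p = n}"
  have fin: "finite (?L n)" for n using finite_lists_length_eq[OF S] .
  have nonneg: "0 \<le> (\<Prod>m\<leftarrow>p. w m)" for p by (intro prod_list_nonneg) (auto simp: assms(1))
  have le: "(\<Sum>m\<in>S. w m) \<le> 1 / 2"
    using sum_le_suminf[OF assms(2) S] assms(1,3) by force
  have "(\<Sum>p\<in>F. \<Prod>m\<leftarrow>p. w m) \<le> (\<Sum>p\<in>(\<Union>n\<in>{N..<M}. ?L n). \<Prod>m\<leftarrow>p. w m)"
  proof (rule sum_mono2)
    show "F \<subseteq> (\<Union>n\<in>{N..<M}. ?L n)" using M assms(5) by (auto simp: S_def)
  qed (use fin nonneg in auto)
  also have "\<dots> = (\<Sum>n\<in>{N..<M}. \<Sum>p\<in>?L n. \<Prod>m\<leftarrow>p. w m)"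
    using fin by (intro sum.UNION_disjoint) auto
  also have "\<dots> = (\<Sum>n\<in>{N..<M}. (\<Sum>m\<in>S. w m) ^ n)"
    by (simp add: sum_weights_lists[OF S])
  also have "\<dots> \<le> (\<Sum>n\<in>{N..<M}. (1 / 2) ^ n)"
    using le assms(1) by (intro sum_mono power_mono sum_nonneg) auto
  also have "\<dots> \<le> 2 * (1 / 2) ^ N"
  proof (cases "N \<le> M")
    case True
    then have "(\<Sum>n\<in>{N..<M}. (1 / 2 :: real) ^ n) = 2 * ((1 / 2) ^ N - (1 / 2) ^ M)"
      by (induction M rule: dec_induct) simp_all
    then show ?thesis by simp
  qed simp
  finally show ?thesis .
qed

text \<open>A Borel-Cantelli argument: \<open>A\<close> is covered by the pieces of the words of
  length at least \<open>N\<close> for every \<open>N\<close>, and the cost of these pieces is a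
  geometric tail in \<open>N\<close>.\<close>

lemma hausdorff_measure_zero_listI:
  fixes J :: "nat list \<Rightarrow> 'a::metric_space set" and w :: "nat \<Rightarrow> real"
  assumes w: "\<And>m. 0 \<le> w m" "summable w" "suminf w \<le> 1 / 2"
    and J: "\<And>p. bounded (J p)" "\<And>p. diameter (J p) powr s \<le> (\<Prod>m\<leftarrow>p. w m)"
    and small: "\<And>p. diameter (J p) \<le> (1 / 2) ^ length p"
    and cover: "\<And>N. A \<subseteq> (\<Union>p\<in>{p. length p \<ge> N}. J p)"
    and "s > 0"
  shows "hausdorff_measure s A = 0"
proof -
  have pre: "hausdorff_premeasure s d A \<le> ennreal e" if "d > 0" "e > 0" for d e
  proof -
    \<comment> \<open>One \<open>N\<close> serves both purposes: it makes the pieces finer than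
      \<open>d\<close> and the tail \<open>2 * (1 / 2) ^ N\<close> at most \<open>e\<close>.\<close>
    obtain N where N: "(1 / 2 :: real) ^ N < min d (e / 2)"
      using real_arch_pow_inv[of "min d (e / 2)" "1 / 2"] \<open>d > 0\<close> \<open>e > 0\<close> by auto
    then have N: "(1 / 2 :: real) ^ N \<le> d" "2 * (1 / 2 :: real) ^ N \<le> e" by linarith+
    \<comment> \<open>Covers are sequences, so the countable set of words is enumerated; short words
      will contribute the empty set, of weight 0.\<close>
    define q :: "nat \<Rightarrow> nat list" where "q = from_nat_into UNIV"
    have q: "bij q"
      unfolding q_def by (intro bij_betw_from_nat_into) (auto simp: infinite_UNIV_listI)
    define U where "U i = (if length (q i) \<ge> N then J (q i) else {})" for i
    have "U \<in> hausdorff_covers d A"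
    proof -
      have "x \<in> (\<Union>i. U i)" if "x \<in> A" for x
      proof -
        obtain p where "length p \<ge> N" "x \<in> J p"
          using subsetD[OF cover[of N] \<open>x \<in> A\<close>] by blast
        moreover obtain i where "p = q i" using q by (metis bij_pointE)
        ultimately show ?thesis by (auto simp: U_def)
      qed
      moreover have "diameter (U i) \<le> d" for i
      proof (cases "length (q i) \<ge> N")
        case True
        then have "(1 / 2 :: real) ^ length (q i) \<le> (1 / 2) ^ N" by (intro power_decreasing) auto
        then have "diameter (J (q i)) \<le> d" using small[of "q i"] N(1) by linarith
        then show ?thesis using True by (simp add: U_def)
      qed (use \<open>d > 0\<close> in \<open>simp add: U_def\<close>)
      ultimately show ?thesis using J(1) by (auto simp: hausdorff_covers_def U_def)
    qed
    then have "hausdorff_premeasure s d A \<le> (\<Sum>i. hausdorff_weight s (U i))"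
      unfolding hausdorff_premeasure_def by (rule INF_lower)
    also have "\<dots> \<le> ennreal e"
    proof (rule suminf_le_const[OF summableI])
      fix n
      let ?F = "{p \<in> q ` {..<n}. length p \<ge> N}"
      have w_nonneg: "0 \<le> (\<Prod>m\<leftarrow>p. w m)" for p by (intro prod_list_nonneg) (auto simp: w(1))
      have "(\<Sum>i<n. hausdorff_weight s (U i))
          \<le> (\<Sum>i<n. ennreal (if length (q i) \<ge> N then \<Prod>m\<leftarrow>q i. w m else 0))"
        using J(2) \<open>s > 0\<close>
        by (intro sum_mono) (auto simp: U_def hausdorff_weight_def intro: ennreal_leI)
      also have "\<dots> = ennreal (\<Sum>i<n. if length (q i) \<ge> N then \<Prod>m\<leftarrow>q i. w m else 0)"
        using w_nonneg by (intro sum_ennreal) auto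
      also have "(\<Sum>i<n. if length (q i) \<ge> N then \<Prod>m\<leftarrow>q i. w m else 0)
          = (\<Sum>p\<in>q ` {..<n}. if length p \<ge> N then \<Prod>m\<leftarrow>p. w m else 0)"
        using q by (subst sum.reindex) (auto intro: inj_on_subset simp: bij_def)
      also have "\<dots> = (\<Sum>p\<in>?F. \<Prod>m\<leftarrow>p. w m)"
        by (simp add: sum.inter_filter)
      also have "ennreal \<dots> \<le> ennreal e"
      proof (rule ennreal_leI)
        have "(\<Sum>p\<in>?F. \<Prod>m\<leftarrow>p. w m) \<le> 2 * (1 / 2) ^ N"
          by (rule sum_weights_long_lists[OF w]) auto
        then show "(\<Sum>p\<in>?F. \<Prod>m\<leftarrow>p. w m) \<le> e" using N(2) by linarith
      qed
      finally show "(\<Sum>i<n. hausdorff_weight s (U i)) \<le> ennreal e" .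
    qed
    finally show ?thesis .
  qed
  have "hausdorff_premeasure s d A \<le> 0" if "d > 0" for d
  proof (rule ennreal_le_epsilon)
    show "hausdorff_premeasure s d A \<le> 0 + ennreal e" if "0 < e" for e
      using pre[OF \<open>d > 0\<close> that] by simp
  qed
  then have "hausdorff_measure s A \<le> 0"
    unfolding hausdorff_measure_def by (intro SUP_least) simp
  then show ?thesis by simp
qed

section \<open>The upper bound\<close>

text \<open>A rate \<tau> strictly between \<beta> and \<gamma> leaves room for the linear term:
  \<open>C * \<tau> ^ n\<close> dominates the recursion for large \<open>C\<close>, and is itself
  negligible against \<open>\<gamma> ^ n\<close>.\<close>

lemma growth_dominated:
  fixes l :: "nat \<Rightarrow> real"
  assumes "1 < \<beta>" "\<beta> < \<gamma>" "L > 0"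
    and rec: "\<And>n. n \<ge> N \<Longrightarrow> l (Suc n) \<le> real (Suc n) * d + \<beta> * l n"
  shows "eventually (\<lambda>n. l n < L * \<gamma> ^ n) sequentially"
proof -
  define \<tau> where "\<tau> = (\<beta> + \<gamma>) / 2"
  have \<tau>: "\<beta> < \<tau>" "\<tau> < \<gamma>" "1 < \<tau>" using assms by (auto simp: \<tau>_def)
  have "(\<lambda>n. real (Suc n) * d / ((\<tau> - \<beta>) * \<tau> ^ n)) \<longlonglongrightarrow> 0"
    using \<tau> by real_asymp
  then have "Bseq (\<lambda>n. real (Suc n) * d / ((\<tau> - \<beta>) * \<tau> ^ n))"
    by (rule convergentI[THEN convergent_imp_Bseq])
  then obtain C1 where "\<And>n. norm (real (Suc n) * d / ((\<tau> - \<beta>) * \<tau> ^ n)) \<le> C1"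
    unfolding Bseq_def by blast
  then have C1: "real (Suc n) * d / ((\<tau> - \<beta>) * \<tau> ^ n) \<le> C1" for n
    unfolding real_norm_def by (rule abs_le_D1)
  \<comment> \<open>\<open>C1\<close> absorbs the term \<open>Suc n * d\<close> in the induction
    step; the other entry starts the induction at \<open>N\<close>.\<close>
  define C where "C = max C1 (l N / \<tau> ^ N)"
  have bound: "l n \<le> C * \<tau> ^ n" if "n \<ge> N" for n
    using that
  proof (induction n rule: dec_induct)
    case base
    have "l N / \<tau> ^ N \<le> C" by (simp add: C_def)
    then show ?case using \<tau> by (simp add: divide_le_eq)
  next
    case (step n)
    have "real (Suc n) * d / ((\<tau> - \<beta>) * \<tau> ^ n) \<le> C" using C1[of n] by (simp add: C_def)
    then have "real (Suc n) * d \<le> C * ((\<tau> - \<beta>) * \<tau> ^ n)"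
      using \<tau> by (simp add: divide_le_eq)
    moreover have "\<beta> * l n \<le> \<beta> * (C * \<tau> ^ n)" using step assms by (intro mult_left_mono) auto
    ultimately show ?case using rec[of n] step by (simp add: algebra_simps)
  qed
  have "(\<lambda>n. C * \<tau> ^ n / \<gamma> ^ n) \<longlonglongrightarrow> 0" using \<tau> by real_asymp
  then have "eventually (\<lambda>n. C * \<tau> ^ n / \<gamma> ^ n < L) sequentially"
    using \<open>L > 0\<close> by (rule order_tendstoD)
  then show ?thesis using eventually_ge_at_top[of N]
  proof eventually_elim
    case (elim n)
    then have "C * \<tau> ^ n < L * \<gamma> ^ n" using assms by (simp add: divide_less_eq)
    then show ?case using bound[of n] elim by simp
  qed
qed

lemma real_prod_list_upt:
  "real (prod_list (map f [0..<n])) = (\<Prod>j<n. real (f j))"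
  by (induction n) (simp_all add: mult.commute)

text \<open>
  Otherwise \<open>ln (a\<^sub>2 a\<^sub>4 \<dots> a\<^bsub>2n\<^esub>)\<close> would grow at most like \<open>\<tau>\<^sup>n\<close> for some \<open>\<tau> < b\<^sup>2\<close>.
\<close>

lemma E_inf_digit_recurs:
  assumes "b > 1" "c > 1" "1 < \<beta>" "\<beta> < b\<^sup>2" "D \<ge> 1" "x \<in> E_inf b c"
  shows "\<exists>n\<ge>N. real (even_digit n x) \<ge> D ^ Suc n * (\<Prod>j<n. real (even_digit j x)) powr (\<beta> - 1)"
proof (rule ccontr)
  assume "\<not> ?thesis"
  then have small: "real (even_digit n x) < D ^ Suc n * (\<Prod>j<n. real (even_digit j x)) powr (\<beta> - 1)"
    if "n \<ge> N" for n
    using that by force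
  have x: "x \<in> I_even" using assms by (simp add: E_inf_def)
  define m where "m n = real (even_digit n x)" for n
  define l where "l n = ln (\<Prod>j<n. m j)" for n
  have m_ge: "m n \<ge> 1" for n using even_digit_ge_1[OF x, of n] by (simp add: m_def)
  have prod_ge: "(\<Prod>j<n. m j) \<ge> 1" for n by (rule prod_ge_1) (use m_ge in auto)
  have m_pos: "m n > 0" and prod_pos: "(\<Prod>j<n. m j) > 0" for n
    using m_ge[of n] prod_ge[of n] by linarith+
  have m_ne: "m n \<noteq> 0" for n using m_pos[of n] by simp
  have l_Suc: "l (Suc n) = l n + ln (m n)" for n
    using ln_mult_pos[OF prod_pos[of n] m_pos[of n]] by (simp add: l_def)
  have l_nonneg: "0 \<le> l n" for n using prod_ge[of n] by (simp add: l_def)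
  \<comment> \<open>The logarithm of the negated claim bounds \<open>ln (m n)\<close> by a linear
    term plus \<open>(\<beta> - 1) * l n\<close>; adding \<open>l n\<close> gives the recursion of
    \<open>growth_dominated\<close>.\<close>
  have "l (Suc n) \<le> real (Suc n) * ln D + \<beta> * l n" if "n \<ge> N" for n
  proof -
    have "ln (m n) \<le> ln (D ^ Suc n * (\<Prod>j<n. m j) powr (\<beta> - 1))"
      using small[OF that] m_pos[of n] by (simp add: m_def)
    also have "\<dots> = real (Suc n) * ln D + (\<beta> - 1) * l n"
      using \<open>D \<ge> 1\<close> m_ne by (simp add: ln_mult ln_realpow l_def del: power_Suc)
    finally show ?thesis by (simp add: l_Suc algebra_simps)
  qed
  then have "eventually (\<lambda>n. l n < ln c * (b\<^sup>2) ^ n) sequentially"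
    using assms by (intro growth_dominated) auto
  then obtain N' where N': "l n < ln c * (b\<^sup>2) ^ n" if "n \<ge> N'" for n
    by (auto simp: eventually_sequentially)
  have "n \<le> N'" if n: "n \<ge> 1" "real_of_int (partial_quotient (2 * n) x) \<ge> c powr (b ^ (2 * n))" for n
  proof (rule ccontr)
    assume "\<not> n \<le> N'"
    obtain k where k: "n = Suc k" using n by (cases n) auto
    \<comment> \<open>The quotient with index \<open>2 * n\<close> is digit
      \<open>k = n - 1\<close>, so \<open>l n\<close> already contains its logarithm and the other
      summands are nonnegative.\<close>
    have "ln (m k) < ln c * (b\<^sup>2) ^ n"
      using l_Suc[of k] l_nonneg[of k] N'[of n] \<open>\<not> n \<le> N'\<close> k by simp
    moreover have "c powr (b ^ (2 * n)) \<le> m k"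
      using n(2) partial_quotient_even[OF x, of k] by (simp add: k m_def)
    then have "ln (c powr (b ^ (2 * n))) \<le> ln (m k)"
      using \<open>c > 1\<close> by (intro ln_mono) auto
    then have "ln c * (b\<^sup>2) ^ n \<le> ln (m k)"
      by (simp add: mult.commute flip: power_mult)
    ultimately show False by simp
  qed
  then have "{n. n \<ge> 1 \<and> real_of_int (partial_quotient (2 * n) x) \<ge> c powr (b ^ (2 * n))} \<subseteq> {..N'}"
    by auto
  moreover have "infinite {n. n \<ge> 1 \<and> real_of_int (partial_quotient (2 * n) x) \<ge> c powr (b ^ (2 * n))}"
    using assms(6) by (simp add: E_inf_def)
  ultimately show False using finite_subset by blast
qed

text \<open>Turns the diameter bound of a word, raised to the power \<open>s\<close>, into a product
  of letter weights, as \<open>hausdorff_measure_zero_listI\<close> demands.\<close>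

lemma prod_list_geometric_powr:
  fixes r \<gamma> s :: real
  assumes "r \<ge> 0"
  shows "(\<Prod>m\<leftarrow>p. (r * real m powr \<gamma>) powr s) = (r ^ length p * real (prod_list p) powr \<gamma>) powr s"
proof (induction p)
  case (Cons m p)
  have "real (prod_list (m # p)) powr \<gamma> = real m powr \<gamma> * real (prod_list p) powr \<gamma>"
    by (simp add: powr_mult)
  then have "r ^ length (m # p) * real (prod_list (m # p)) powr \<gamma>
      = (r * real m powr \<gamma>) * (r ^ length p * real (prod_list p) powr \<gamma>)" by simp
  then show ?case using Cons assms by (simp add: powr_mult)
qed simp

lemma prod_list_ge_1_nat:
  fixes p :: "nat list"
  assumes "\<forall>m\<in>set p. m \<ge> 1"
  shows "prod_list p \<ge> 1"
  using assms by (induction p) (auto simp: Suc_le_eq)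

lemma hausdorff_measure_E_inf:
  assumes "b > 1" "c > 1" "s > 1 / (1 + b\<^sup>2)"
  shows "hausdorff_measure s (E_inf b c) = 0"
proof -
  have b2: "b\<^sup>2 > 1" using \<open>b > 1\<close> by simp
  then have "s > 0" using assms(3) by (smt (verit) divide_pos_pos)
  have "1 < s * (1 + b\<^sup>2)" using assms(3) b2 by (simp add: divide_less_eq)
  then have "1 / s - 1 < b\<^sup>2" using \<open>s > 0\<close> by (simp add: field_simps)
  \<comment> \<open>\<open>\<beta> > 1 / s - 1\<close> makes the letter weights summable, while
    \<open>1 < \<beta> < b\<^sup>2\<close> is the range in which large digits recur.\<close>
  then obtain \<beta> where \<beta>: "max 1 (1 / s - 1) < \<beta>" "\<beta> < b\<^sup>2"
    using dense[of "max 1 (1 / s - 1)" "b\<^sup>2"] b2 by auto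
  then have \<beta>1: "1 < \<beta>" and "1 / s < 1 + \<beta>" by auto
  then have \<alpha>: "- (1 + \<beta>) * s < - 1" using \<open>s > 0\<close> by (simp add: field_simps)
  define Z where "Z = (\<Sum>m. real m powr (- (1 + \<beta>) * s))"
  have summ: "summable (\<lambda>m. real m powr (- (1 + \<beta>) * s))"
    using \<alpha> by (simp only: summable_real_powr_iff)
  have Z: "Z \<ge> 0" unfolding Z_def by (rule suminf_nonneg[OF summ]) simp
  \<comment> \<open>\<open>D\<close> makes the weights of single digits sum to at most \<open>1 / 2\<close>\<close>
  define D where "D = max 2 ((2 * Z) powr (1 / s))"
  have D: "D \<ge> 2" by (simp add: D_def)
  have "2 * Z = ((2 * Z) powr (1 / s)) powr s" using Z \<open>s > 0\<close> by (simp add: powr_powr)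
  also have "\<dots> \<le> D powr s" using \<open>s > 0\<close> by (intro powr_mono2) (auto simp: D_def)
  finally have DZ: "2 * Z \<le> D powr s" .

  define w where "w m = (1 / D * real m powr (- (1 + \<beta>))) powr s" for m :: nat
  have w_eq: "w m = (1 / D) powr s * real m powr (- (1 + \<beta>) * s)" for m
    using D by (simp only: w_def powr_mult powr_powr)
  have w: "0 \<le> w m" for m by (simp add: w_def)
  have w_summable: "summable w"
    unfolding w_eq using summ by (rule summable_mult)
  have "suminf w = (1 / D) powr s * Z"
    unfolding w_eq Z_def using suminf_mult[OF summ] by simp
  also have "\<dots> = Z / D powr s" using D by (simp add: powr_divide)
  also have "\<dots> \<le> 1 / 2" using DZ D by (simp add: divide_le_eq)
  finally have w_half: "suminf w \<le> 1 / 2" .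

  define Q where "Q p = real (prod_list p)" for p :: "nat list"
  \<comment> \<open>\<open>K p\<close> is the threshold for the digit following \<open>p\<close>. A
    tail whose first digit is at least \<open>K p\<close> lies within \<open>1 / K p\<close> of 1,
    hence the interval in \<open>J\<close>. Words containing 0 are not digit sequences and get an
    empty piece.\<close>
  define K where "K p = D ^ Suc (length p) * Q p powr (\<beta> - 1)" for p
  define J where "J p = (if \<forall>m\<in>set p. m \<ge> 1 then foldr even_branch p ` {1 - 1 / K p..1} else {})" for p
  have K: "K p \<ge> D ^ Suc (length p)" "K p \<ge> 1" and Q: "Q p \<ge> 1" if "\<forall>m\<in>set p. m \<ge> 1" for p
  proof -
    show Q: "Q p \<ge> 1" using prod_list_ge_1_nat[OF that] by (simp add: Q_def del: One_nat_def)
    then have "Q p powr (\<beta> - 1) \<ge> 1" using \<beta>1 by (simp add: ge_one_powr_ge_zero)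
    moreover have D1: "1 \<le> D ^ Suc (length p)" using D by (intro one_le_power) auto
    ultimately show K1: "K p \<ge> D ^ Suc (length p)"
      unfolding K_def using mult_left_mono[of 1 "Q p powr (\<beta> - 1)" "D ^ Suc (length p)"] by linarith
    show "K p \<ge> 1" using K1 D1 by linarith
  qed
  have J_sub: "J p \<subseteq> {0..1}" for p
  proof (cases "\<forall>m\<in>set p. m \<ge> 1")
    case True
    have "{1 - 1 / K p..1} \<subseteq> {0..1}" using K(2)[OF True] by simp
    then have "foldr even_branch p ` {1 - 1 / K p..1} \<subseteq> {0..1}"
      by (meson foldr_even_branch_range image_subsetI subsetD)
    then show ?thesis using True unfolding J_def by simp
  qed (auto simp: J_def)
  have J_diam: "diameter (J p) \<le> 1 / (K p * (Q p)\<^sup>2)" if p: "\<forall>m\<in>set p. m \<ge> 1" for p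
  proof (rule diameter_le)
    have K1: "1 / K p \<le> 1" "0 < K p" using K(2)[OF p] by auto
    show "J p \<noteq> {} \<or> 0 \<le> 1 / (K p * (Q p)\<^sup>2)" using K1 by simp
    fix x y assume "x \<in> J p" "y \<in> J p"
    then obtain u v where uv: "u \<in> {1 - 1 / K p..1}" "v \<in> {1 - 1 / K p..1}"
      "x = foldr even_branch p u" "y = foldr even_branch p v" using p by (auto simp: J_def)
    have "u \<in> {0..1}" "v \<in> {0..1}"
      using uv(1,2) K1(1) unfolding atLeastAtMost_iff by linarith+
    then have "norm (x - y) \<le> \<bar>u - v\<bar> / (Q p)\<^sup>2"
      using foldr_even_branch_contracts[OF p] uv(3,4) by (simp add: Q_def)
    also have "\<dots> \<le> (1 / K p) / (Q p)\<^sup>2"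
      using uv by (intro divide_right_mono) auto
    finally show "norm (x - y) \<le> 1 / (K p * (Q p)\<^sup>2)" by simp
  qed
  have diam_eq: "1 / (K p * (Q p)\<^sup>2) = (1 / D) ^ Suc (length p) * Q p powr (- (1 + \<beta>))"
    if p: "\<forall>m\<in>set p. m \<ge> 1" for p
  proof -
    have "Q p > 0" using Q[OF p] by simp
    then have "Q p powr (\<beta> - 1) * (Q p)\<^sup>2 = Q p powr (1 + \<beta>)"
      by (simp add: powr_add[symmetric] flip: powr_numeral)
    then have "K p * (Q p)\<^sup>2 = D ^ Suc (length p) * Q p powr (1 + \<beta>)"
      by (simp add: K_def mult.assoc)
    then show ?thesis
      unfolding powr_minus_divide by (simp add: power_one_over del: power_Suc)
  qed
  show ?thesis
  proof (rule hausdorff_measure_zero_listI[OF w w_summable w_half])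
    fix p :: "nat list"
    show "bounded (J p)" using J_sub by (rule bounded_subset[rotated]) simp
    show "diameter (J p) powr s \<le> (\<Prod>m\<leftarrow>p. w m)"
    proof (cases "\<forall>m\<in>set p. m \<ge> 1")
      case True
      have "diameter (J p) \<le> (1 / D) ^ Suc (length p) * Q p powr (- (1 + \<beta>))"
        using J_diam[OF True] diam_eq[OF True] by simp
      \<comment> \<open>The surplus factor \<open>1 / D\<close> is given away so that exactly one
        such factor belongs to each letter.\<close>
      also have "\<dots> \<le> (1 / D) ^ length p * Q p powr (- (1 + \<beta>))"
        using D by (intro mult_right_mono power_decreasing) auto
      finally have "diameter (J p) powr s \<le> ((1 / D) ^ length p * Q p powr (- (1 + \<beta>))) powr s"
        using \<open>s > 0\<close> J_sub[of p]
        by (intro powr_mono2) (auto intro!: diameter_ge_0 bounded_subset[OF bounded_closed_interval])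
      also have "\<dots> = (\<Prod>m\<leftarrow>p. w m)"
        using prod_list_geometric_powr[of "1 / D"] D by (simp add: w_def Q_def)
      finally show ?thesis .
    next
      case False
      then have "J p = {}" by (auto simp: J_def)
      moreover have "0 \<le> (\<Prod>m\<leftarrow>p. w m)" by (intro prod_list_nonneg) (auto simp: w)
      ultimately show ?thesis by simp
    qed
    show "diameter (J p) \<le> (1 / 2) ^ length p"
    proof (cases "\<forall>m\<in>set p. m \<ge> 1")
      case True
      have "Q p powr (- (1 + \<beta>)) \<le> Q p powr 0" using \<beta>1 Q[OF True] by (intro powr_mono) auto
      then have Q1: "Q p powr (- (1 + \<beta>)) \<le> 1" using Q[OF True] by simp
      have "diameter (J p) \<le> (1 / D) ^ Suc (length p) * Q p powr (- (1 + \<beta>))"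
        using J_diam[OF True] diam_eq[OF True] by simp
      also have "\<dots> \<le> (1 / D) ^ Suc (length p) * 1"
        using D Q1 by (intro mult_left_mono) auto
      also have "\<dots> \<le> (1 / D) ^ length p * 1"
        using D by (intro mult_right_mono power_decreasing) auto
      also have "\<dots> \<le> (1 / 2) ^ length p"
        using D by (simp add: power_mono frac_le)
      finally show ?thesis .
    qed (auto simp: J_def)
  next
    fix N
    show "E_inf b c \<subseteq> (\<Union>p\<in>{p. N \<le> length p}. J p)"
    proof
      fix x assume "x \<in> E_inf b c"
      then have x: "x \<in> I_even" by (simp add: E_inf_def)
      obtain n where n: "n \<ge> N"
        "real (even_digit n x) \<ge> D ^ Suc n * (\<Prod>j<n. real (even_digit j x)) powr (\<beta> - 1)"
        using E_inf_digit_recurs[OF assms(1,2) \<beta>1 \<beta>(2) _ \<open>x \<in> E_inf b c\<close>, of D N] D by auto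
      define p where "p = map (\<lambda>j. even_digit j x) [0..<n]"
      define y where "y = (gauss2 ^^ n) x"
      have y: "y \<in> I_even" using I_even_funpow[OF x] by (simp add: y_def)
      have p1: "\<forall>m\<in>set p. m \<ge> 1" using even_digit_ge_1[OF x] by (auto simp: p_def)
      \<comment> \<open>The digit of \<open>x\<close> at position \<open>n\<close> is the first
        digit of the tail \<open>y\<close>.\<close>
      have "K p \<le> real (even_digit 0 y)"
        using n(2) even_digit_funpow[of n x]
        by (simp add: K_def Q_def p_def y_def real_prod_list_upt)
      moreover have "0 \<le> gauss2 y" by (simp add: gauss2_def gauss_map_range)
      ultimately have "1 / (real (even_digit 0 y) + 1 + gauss2 y) \<le> 1 / K p"
        using K(2)[OF p1] by (intro divide_left_mono) auto
      then have "1 - 1 / K p \<le> y"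
        by (subst I_even_decomposition(3)[OF y]) (simp add: even_branch_def)
      then have "y \<in> {1 - 1 / K p..1}" using I_even_bounds[OF y] by simp
      moreover have "x = foldr even_branch p y"
        using I_even_foldr[OF x] by (simp add: p_def y_def)
      ultimately have "x \<in> J p" using p1 by (auto simp: J_def)
      moreover have "length p = n" by (simp add: p_def)
      ultimately show "x \<in> (\<Union>p\<in>{p. N \<le> length p}. J p)" using n(1) by auto
    qed
  qed (use \<open>s > 0\<close> in simp)
qed

section \<open>Mixed radix expansions\<close>

text \<open>The Cantor series of \<open>t\<close> with radices \<open>M k\<close>: the remainder
  after \<open>k\<close> digits, rescaled to the unit interval.\<close>

fun radix_rest :: "(nat \<Rightarrow> nat) \<Rightarrow> nat \<Rightarrow> real \<Rightarrow> real" where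
  "radix_rest M 0 t = t"
| "radix_rest M (Suc k) t = frac (real (M k) * radix_rest M k t)"

definition radix_digit :: "(nat \<Rightarrow> nat) \<Rightarrow> nat \<Rightarrow> real \<Rightarrow> nat" where
  "radix_digit M k t = nat \<lfloor>real (M k) * radix_rest M k t\<rfloor>"

lemma radix_rest_range:
  assumes "t \<in> {0..<1}"
  shows "0 \<le> radix_rest M k t" "radix_rest M k t < 1"
  using assms by (cases k; simp add: frac_lt_1)+

lemma radix_digit_step:
  assumes "t \<in> {0..<1}"
  shows "real (M k) * radix_rest M k t = real (radix_digit M k t) + radix_rest M (Suc k) t"
proof -
  have "0 \<le> \<lfloor>real (M k) * radix_rest M k t\<rfloor>"
    using radix_rest_range[OF assms] by simp
  then show ?thesis by (simp add: radix_digit_def frac_def)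
qed

lemma radix_digit_less:
  assumes "t \<in> {0..<1}" "M k > 0"
  shows "radix_digit M k t < M k"
proof -
  have "real (M k) * radix_rest M k t < real (M k) * 1"
    using radix_rest_range[OF assms(1)] assms(2) by (intro mult_strict_left_mono) auto
  then have "real (radix_digit M k t) < real (M k)"
    using radix_digit_step[OF assms(1), of M k] radix_rest_range[OF assms(1), of M "Suc k"]
    by linarith
  then show ?thesis by simp
qed

text \<open>Equal digits cancel in \<open>radix_digit_step\<close>, so each step merely stretches
  the difference by the radix.\<close>

lemma radix_diff:
  assumes "s \<in> {0..<1}" "t \<in> {0..<1}" "\<And>j. j < n \<Longrightarrow> radix_digit M j s = radix_digit M j t"
  shows "(\<Prod>j<n. real (M j)) * (s - t) = radix_rest M n s - radix_rest M n t"
  using assms(3)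
proof (induction n)
  case (Suc n)
  have "(\<Prod>j<Suc n. real (M j)) * (s - t) = real (M n) * ((\<Prod>j<n. real (M j)) * (s - t))"
    by simp
  also have "\<dots> = real (M n) * radix_rest M n s - real (M n) * radix_rest M n t"
    using Suc by (simp add: right_diff_distrib)
  also have "\<dots> = radix_rest M (Suc n) s - radix_rest M (Suc n) t"
    using radix_digit_step assms(1,2) Suc.prems[of n] by (simp del: radix_rest.simps)
  finally show ?case .
qed simp

text \<open>If all digits agreed, the difference would be stretched by at least \<open>2 ^ n\<close>
  yet stay below 1. At the first disagreement the remainders add less than 1 to a digit gap of at
  least 1, whence the factor 2.\<close>

lemma radix_first_difference:
  assumes st: "s \<in> {0..<1}" "t \<in> {0..<1}" and "s \<noteq> t" and M: "\<And>k. M k \<ge> 2"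
  shows "\<exists>n. (\<forall>j<n. radix_digit M j s = radix_digit M j t)
    \<and> radix_digit M n s \<noteq> radix_digit M n t
    \<and> \<bar>s - t\<bar> * (\<Prod>j\<le>n. real (M j)) \<le> 2 * \<bar>real (radix_digit M n s) - real (radix_digit M n t)\<bar>"
proof -
  have "\<exists>n. radix_digit M n s \<noteq> radix_digit M n t"
  proof (rule ccontr)
    assume "\<not> ?thesis"
    then have eq: "(\<Prod>j<n. real (M j)) * (s - t) = radix_rest M n s - radix_rest M n t" for n
      using radix_diff[OF st] by blast
    obtain n where n: "1 / \<bar>s - t\<bar> < 2 ^ n"
      using real_arch_pow[of 2 "1 / \<bar>s - t\<bar>"] by auto
    have "(2::real) ^ n = (\<Prod>j<n. 2)" by simp
    also have "\<dots> \<le> (\<Prod>j<n. real (M j))"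
      using M by (intro prod_mono) (metis of_nat_le_iff of_nat_numeral zero_le_numeral)
    finally have "1 / \<bar>s - t\<bar> < (\<Prod>j<n. real (M j))" using n by simp
    then have "1 < (\<Prod>j<n. real (M j)) * \<bar>s - t\<bar>" using \<open>s \<noteq> t\<close> by (simp add: divide_less_eq)
    also have "\<dots> = \<bar>radix_rest M n s - radix_rest M n t\<bar>"
      using arg_cong[OF eq[of n], of abs] by (simp add: abs_mult abs_prod)
    also have "\<dots> < 1"
      using radix_rest_range[OF st(1), of M n] radix_rest_range[OF st(2), of M n] by linarith
    finally show False .
  qed
  then obtain n where n: "radix_digit M n s \<noteq> radix_digit M n t"
    "\<And>j. j < n \<Longrightarrow> radix_digit M j s = radix_digit M j t"
    using exists_least_iff[of "\<lambda>n. radix_digit M n s \<noteq> radix_digit M n t"] by blast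
  let ?d = "real (radix_digit M n s) - real (radix_digit M n t)"
  have step: "real (M n) * (radix_rest M n s - radix_rest M n t)
      = ?d + (radix_rest M (Suc n) s - radix_rest M (Suc n) t)"
    using radix_digit_step[OF st(1), of M n] radix_digit_step[OF st(2), of M n]
    by (simp add: right_diff_distrib del: radix_rest.simps)
  have "\<bar>s - t\<bar> * (\<Prod>j\<le>n. real (M j)) = \<bar>real (M n) * ((\<Prod>j<n. real (M j)) * (s - t))\<bar>"
    by (simp add: abs_mult abs_prod lessThan_Suc_atMost[symmetric])
  also have "\<dots> = \<bar>?d + (radix_rest M (Suc n) s - radix_rest M (Suc n) t)\<bar>"
    by (simp only: radix_diff[OF st n(2)] step)
  also have "\<dots> \<le> \<bar>?d\<bar> + 1"
    using radix_rest_range[OF st(1), of M "Suc n"] radix_rest_range[OF st(2), of M "Suc n"]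
    by linarith
  also have "\<dots> \<le> 2 * \<bar>?d\<bar>"
  proof -
    have "1 \<le> \<bar>?d\<bar>" using n(1) by auto
    then show ?thesis by simp
  qed
  finally show ?thesis using n by blast
qed

section \<open>The lower bound\<close>

text \<open>
  Since tails of points of \<open>I_even\<close> lie in \<open>[1/2, 1)\<close>, distinct digits force a gap
  proportional to their difference.
\<close>

lemma I_even_separation:
  assumes x: "x \<in> I_even" "y \<in> I_even"
    and eq: "\<And>j. j < n \<Longrightarrow> even_digit j x = even_digit j y"
    and ne: "even_digit n x \<noteq> even_digit n y"
    and M: "\<And>j. j \<le> n \<Longrightarrow> even_digit j x + 2 \<le> 3 * M j" "even_digit n y + 2 \<le> 3 * M n"
  shows "\<bar>real (even_digit n x) - real (even_digit n y)\<bar> / (2 * (\<Prod>j\<le>n. 3 * real (M j))\<^sup>2) \<le> \<bar>x - y\<bar>"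
proof -
  define u where "u = (gauss2 ^^ n) x"
  define v where "v = (gauss2 ^^ n) y"
  define p where "p = map (\<lambda>j. even_digit j x) [0..<n]"
  have uv: "u \<in> I_even" "v \<in> I_even" using I_even_funpow x by (auto simp: u_def v_def)
  have xy: "x = foldr even_branch p u" "y = foldr even_branch p v"
  proof -
    show "x = foldr even_branch p u" using I_even_foldr[OF x(1)] by (simp add: p_def u_def)
    have "p = map (\<lambda>j. even_digit j y) [0..<n]" using eq by (simp add: p_def)
    then show "y = foldr even_branch p v" using I_even_foldr[OF x(2)] by (simp add: v_def)
  qed
  define i where "i = even_digit n x"
  define j where "j = even_digit n y"
  have ij: "even_digit 0 u = i" "even_digit 0 v = j"
    using even_digit_funpow by (simp_all add: i_def j_def u_def v_def)
  define u' where "u' = gauss2 u"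
  define v' where "v' = gauss2 v"
  have u': "1 / 2 \<le> u'" "u' < 1" and v': "1 / 2 \<le> v'" "v' < 1"
    using I_even_decomposition(1)[OF uv(1)] I_even_decomposition(1)[OF uv(2)] I_even_bounds
    by (auto simp: u'_def v'_def)
  have u_eq: "u = even_branch i u'" and v_eq: "v = even_branch j v'"
    using I_even_decomposition(3) uv ij by (auto simp: u'_def v'_def)
  have M': "real i + 2 \<le> 3 * real (M n)" "real j + 2 \<le> 3 * real (M n)"
    using M(1)[of n] M(2) by (simp_all add: i_def j_def)
  have "\<bar>real i - real j\<bar> \<ge> 1" using ne by (auto simp: i_def j_def)
  \<comment> \<open>The tails differ by less than 1/2, so at least half of the digit gap
    survives.\<close>
  then have num: "\<bar>real i - real j\<bar> / 2 \<le> \<bar>(real i + u') - (real j + v')\<bar>"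
    using u' v' by (cases "real i \<ge> real j") (simp_all add: abs_le_iff abs_real_def)
  have "\<bar>real i - real j\<bar> / 2 / (3 * real (M n))\<^sup>2
      \<le> \<bar>real i - real j\<bar> / 2 / ((real i + 1 + u') * (real j + 1 + v'))"
    unfolding power2_eq_square using u' v' M' by (intro divide_left_mono mult_mono mult_pos_pos) auto
  also have "\<dots> \<le> \<bar>(real i + u') - (real j + v')\<bar> / ((real i + 1 + u') * (real j + 1 + v'))"
    using num u' v' by (intro divide_right_mono) auto
  also have "\<dots> = \<bar>u - v\<bar>"
    unfolding u_eq v_eq using even_branch_diff[of u' v' i j] u' v' by simp
  finally have uv_diff: "\<bar>real i - real j\<bar> / 2 / (3 * real (M n))\<^sup>2 \<le> \<bar>u - v\<bar>" .
  have "(\<Prod>m\<leftarrow>p. real m + 2) = (\<Prod>j<n. real (even_digit j x) + 2)"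
    unfolding p_def by (induction n) (simp_all add: mult.commute comp_def)
  also have "\<dots> \<le> (\<Prod>j<n. 3 * real (M j))"
  proof (intro prod_mono)
    fix k assume "k \<in> {..<n}"
    then show "0 \<le> real (even_digit k x) + 2 \<and> real (even_digit k x) + 2 \<le> 3 * real (M k)"
      using of_nat_mono[OF M(1)[of k], where 'a = real] by simp
  qed
  finally have P: "(\<Prod>m\<leftarrow>p. real m + 2) \<le> (\<Prod>j<n. 3 * real (M j))" .
  have P0: "0 < (\<Prod>m\<leftarrow>p. real m + 2)" for p :: "nat list" by (induction p) auto
  have "\<bar>real i - real j\<bar> / (2 * (\<Prod>j\<le>n. 3 * real (M j))\<^sup>2)
      = \<bar>real i - real j\<bar> / 2 / (3 * real (M n))\<^sup>2 / (\<Prod>j<n. 3 * real (M j))\<^sup>2"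
    by (simp add: lessThan_Suc_atMost[symmetric] power_mult_distrib mult_ac)
  also have "\<dots> \<le> \<bar>u - v\<bar> / (\<Prod>j<n. 3 * real (M j))\<^sup>2"
    using uv_diff by (rule divide_right_mono) simp
  also have "\<dots> \<le> \<bar>u - v\<bar> / (\<Prod>m\<leftarrow>p. real m + 2)\<^sup>2"
  proof (rule divide_left_mono)
    show "(\<Prod>m\<leftarrow>p. real m + 2)\<^sup>2 \<le> (\<Prod>j<n. 3 * real (M j))\<^sup>2"
      using P P0[of p] by (intro power_mono) simp_all
    have "0 < (\<Prod>j<n. 3 * real (M j))" using P P0[of p] by linarith
    then show "0 < (\<Prod>j<n. 3 * real (M j))\<^sup>2 * (\<Prod>m\<leftarrow>p. real m + 2)\<^sup>2"
      using P0[of p] by (intro mult_pos_pos zero_less_power)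
  qed simp
  also have "\<dots> \<le> \<bar>x - y\<bar>"
    unfolding xy using I_even_bounds[OF uv(1)] I_even_bounds[OF uv(2)]
    by (intro foldr_even_branch_expands) auto
  finally show ?thesis by (simp add: i_def j_def)
qed

text \<open>
  The Hoelder parametrisation pulls a cover of \<open>A\<close> back to a cover of the unit interval, whose
  Lebesgue measure then bounds the cover sum from below.
\<close>

lemma hausdorff_measure_nonzero_holderI:
  fixes h :: "real \<Rightarrow> 'a::metric_space"
  assumes h: "\<And>t. t \<in> {0..<1} \<Longrightarrow> h t \<in> A"
    and holder: "\<And>r t. r \<in> {0..<1} \<Longrightarrow> t \<in> {0..<1} \<Longrightarrow> \<bar>r - t\<bar> \<le> C * dist (h r) (h t) powr s"
    and "s \<ge> 0" "C \<ge> 0"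
  shows "hausdorff_measure s A \<noteq> 0"
proof
  assume "hausdorff_measure s A = 0"
  moreover have "hausdorff_premeasure s 1 A \<le> hausdorff_measure s A"
    unfolding hausdorff_measure_def by (rule SUP_upper) simp
  \<comment> \<open>The bound makes the balls below have total length at most 1/2;
    \<open>C + 1\<close> replaces \<open>C\<close> to avoid division by 0.\<close>
  ultimately have "hausdorff_premeasure s 1 A < ennreal (1 / (4 * (C + 1)))"
    using \<open>C \<ge> 0\<close> by simp
  then obtain U where U: "U \<in> hausdorff_covers 1 A"
    and sum_less: "(\<Sum>i. hausdorff_weight s (U i)) < ennreal (1 / (4 * (C + 1)))"
    unfolding hausdorff_premeasure_def by (auto simp: INF_less_iff)
  define T where "T i = {t \<in> {0..<1}. h t \<in> U i}" for i
  \<comment> \<open>The preimage \<open>T i\<close> may fail to be measurable; by the Hoelder bound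
    a closed ball about any of its points contains it.\<close>
  define B where "B i = (if T i = {} then {}
    else cball (SOME t. t \<in> T i) (C * diameter (U i) powr s))" for i
  have T_sub: "T i \<subseteq> B i" for i
  proof
    fix r assume r: "r \<in> T i"
    define t where "t = (SOME t. t \<in> T i)"
    have t: "t \<in> T i" unfolding t_def using r by (rule someI)
    have "dist (h t) (h r) \<le> diameter (U i)"
      using U r t by (intro diameter_bounded_bound) (auto simp: hausdorff_covers_def T_def)
    then have "C * dist (h t) (h r) powr s \<le> C * diameter (U i) powr s"
      using \<open>C \<ge> 0\<close> \<open>s \<ge> 0\<close> by (intro mult_left_mono powr_mono2) auto
    moreover have "\<bar>t - r\<bar> \<le> C * dist (h t) (h r) powr s"
      using r t by (intro holder) (auto simp: T_def)
    ultimately have "r \<in> cball t (C * diameter (U i) powr s)" by (simp add: dist_real_def)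
    then show "r \<in> B i" using r by (auto simp: B_def t_def)
  qed
  have B_meas: "B i \<in> sets lborel" for i by (simp add: B_def)
  have B_le: "emeasure lborel (B i) \<le> ennreal (2 * (C + 1)) * hausdorff_weight s (U i)" for i
  proof (cases "T i = {}")
    case False
    then have "U i \<noteq> {}" by (auto simp: T_def)
    \<comment> \<open>Only an inequality: for \<open>s = 0\<close> and diameter 0 the weight is 1,
      whereas \<open>0 powr 0 = 0\<close>.\<close>
    then have w: "ennreal (diameter (U i) powr s) \<le> hausdorff_weight s (U i)"
      by (auto simp: hausdorff_weight_def powr_def)
    have "emeasure lborel (B i) = ennreal (2 * (C * diameter (U i) powr s))"
      using False \<open>C \<ge> 0\<close> by (simp add: B_def cball_eq_atLeastAtMost)
    also have "\<dots> \<le> ennreal (2 * (C + 1) * diameter (U i) powr s)"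
      by (intro ennreal_leI) (simp add: algebra_simps)
    also have "\<dots> = ennreal (2 * (C + 1)) * ennreal (diameter (U i) powr s)"
      using \<open>C \<ge> 0\<close> by (intro ennreal_mult) auto
    also have "\<dots> \<le> ennreal (2 * (C + 1)) * hausdorff_weight s (U i)"
      using w by (rule mult_left_mono) simp
    finally show ?thesis .
  qed (simp add: B_def)
  have "{0..<1} \<subseteq> (\<Union>i. B i)"
  proof
    fix t :: real assume t: "t \<in> {0..<1}"
    then have "h t \<in> (\<Union>i. U i)" using h[OF t] U by (auto simp: hausdorff_covers_def)
    then obtain i where "t \<in> T i" using t by (auto simp: T_def)
    then show "t \<in> (\<Union>i. B i)" using T_sub by blast
  qed
  then have "emeasure lborel {0..<1::real} \<le> emeasure lborel (\<Union>i. B i)"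
    using B_meas by (intro emeasure_mono sets.countable_UN) auto
  also have "\<dots> \<le> (\<Sum>i. emeasure lborel (B i))"
    using B_meas by (intro emeasure_subadditive_countably) auto
  also have "\<dots> \<le> (\<Sum>i. ennreal (2 * (C + 1)) * hausdorff_weight s (U i))"
    using B_le by (intro suminf_le) auto
  also have "\<dots> = ennreal (2 * (C + 1)) * (\<Sum>i. hausdorff_weight s (U i))"
    by (rule ennreal_suminf_cmult)
  also have "\<dots> \<le> ennreal (2 * (C + 1)) * ennreal (1 / (4 * (C + 1)))"
    using sum_less by (intro mult_left_mono) auto
  also have "\<dots> = ennreal (2 * (C + 1) * (1 / (4 * (C + 1))))"
    using \<open>C \<ge> 0\<close> by (intro ennreal_mult[symmetric]) auto
  also have "2 * (C + 1) * (1 / (4 * (C + 1))) = 1 / 2"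
    using \<open>C \<ge> 0\<close> by (simp add: field_simps)
  finally have "ennreal 1 \<le> ennreal (1 / 2)" by simp
  then show False by (subst (asm) ennreal_le_iff) auto
qed

lemma E_allI:
  assumes "x \<in> I_even" "\<And>k. real (even_digit k x) \<ge> c powr ((b\<^sup>2) ^ Suc k)"
  shows "x \<in> E_all b c"
proof -
  have "real_of_int (partial_quotient (2 * n) x) \<ge> c powr (b ^ (2 * n))" if n: "n \<ge> 1" for n
  proof -
    obtain k where k: "n = Suc k" using n by (cases n) auto
    have "b ^ (2 * n) = (b\<^sup>2) ^ Suc k" unfolding k by (rule power_mult)
    then show ?thesis
      using assms(2)[of k] partial_quotient_even[OF assms(1), of k] by (simp only: k of_int_of_nat_eq)
  qed
  then show ?thesis using assms(1) by (simp add: E_all_def)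
qed

lemma E_all_subset_E_inf: "E_all b c \<subseteq> E_inf b c"
proof -
  have "{n. n \<ge> 1 \<and> real_of_int (partial_quotient (2 * n) x) \<ge> c powr (b ^ (2 * n))} = {1..}"
    if "x \<in> E_all b c" for x
    using that by (auto simp: E_all_def)
  then show ?thesis by (auto simp: E_inf_def E_all_def infinite_Ici)
qed

text \<open>The bounded quantity is the Hoelder factor at the first differing digit
  \<open>n\<close>; the powers of 9 stem from the constant 3 in \<open>I_even_separation\<close>.
  Its logarithm is at most a linear term in \<open>n\<close> minus
  \<open>\<kappa> * B ^ Suc n\<close>.\<close>

lemma holder_constant_bounded:
  fixes B c s :: real and M :: "nat \<Rightarrow> nat"
  assumes "B > 1" "c > 1" "0 \<le> s" "s < 1 / (1 + B)"
    and M: "\<And>k. c powr B ^ Suc k \<le> real (M k)" "\<And>k. real (M k) \<le> 2 * c powr B ^ Suc k"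
  shows "\<exists>C. \<forall>n. real (M n) powr (1 - s) * (\<Prod>j\<le>n. real (M j)) powr (2 * s - 1) * (9 ^ Suc n) powr s \<le> C"
proof -
  define L where "L = ln c"
  have L: "L > 0" using assms by (simp add: L_def)
  have s: "s * (1 + B) < 1" using assms by (simp add: pos_less_divide_eq)
  have "s * 2 \<le> s * (1 + B)" using assms by (intro mult_left_mono) auto
  \<comment> \<open>The exponent \<open>2 * s - 1\<close> is negative, so lower bounds on the
    \<open>M j\<close> bound the power of their product from above.\<close>
  then have s_half: "2 * s < 1" using s by linarith
  define \<kappa> where "\<kappa> = L * (1 - s * (1 + B)) / (B - 1)"
  have \<kappa>: "\<kappa> > 0" using L s assms by (simp add: \<kappa>_def)
  \<comment> \<open>\<open>\<kappa> > 0\<close> is exactly the condition \<open>s < 1 / (1 + B)\<close>\<close>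
  define e where "e n = (1 - 2 * s) * L * B / (B - 1) + real (Suc n) * (s * ln 9) - \<kappa> * B ^ Suc n" for n
  have c_powr: "c powr y = exp (L * y)" for y
    using \<open>c > 1\<close> by (simp add: powr_def L_def mult.commute)
  have geom: "(\<Sum>j\<le>n. B ^ Suc j) = (B ^ Suc (Suc n) - B) / (B - 1)" for n
    using \<open>B > 1\<close> by (induction n) (simp_all add: field_simps)
  have bound: "real (M n) powr (1 - s) * (\<Prod>j\<le>n. real (M j)) powr (2 * s - 1) * (9 ^ Suc n) powr s
      \<le> 2 powr (1 - s) * exp (e n)" for n
  proof -
    have "real (M n) powr (1 - s) \<le> (2 * c powr B ^ Suc n) powr (1 - s)"
      using M(2) s_half assms by (intro powr_mono2) auto
    also have "\<dots> = 2 powr (1 - s) * exp ((1 - s) * L * B ^ Suc n)"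
      by (simp only: powr_mult powr_powr) (simp add: c_powr mult_ac)
    finally have 1: "real (M n) powr (1 - s) \<le> 2 powr (1 - s) * exp ((1 - s) * L * B ^ Suc n)" .
    have "exp (L * (\<Sum>j\<le>n. B ^ Suc j)) = (\<Prod>j\<le>n. c powr B ^ Suc j)"
      by (simp only: c_powr sum_distrib_left exp_sum finite_atMost)
    also have "\<dots> \<le> (\<Prod>j\<le>n. real (M j))"
      using M(1) by (intro prod_mono) auto
    finally have "(\<Prod>j\<le>n. real (M j)) powr (2 * s - 1) \<le> exp (L * (\<Sum>j\<le>n. B ^ Suc j)) powr (2 * s - 1)"
      using s_half by (intro powr_mono2') auto
    also have "\<dots> = exp ((2 * s - 1) * L * ((B ^ Suc (Suc n) - B) / (B - 1)))"
      unfolding geom by (simp add: powr_def)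
    finally have 2: "(\<Prod>j\<le>n. real (M j)) powr (2 * s - 1)
      \<le> exp ((2 * s - 1) * L * ((B ^ Suc (Suc n) - B) / (B - 1)))" .
    have 3: "(9 ^ Suc n) powr s = exp (real (Suc n) * (s * ln 9))"
      by (simp add: powr_def ln_realpow mult_ac del: power_Suc)
    have "real (M n) powr (1 - s) * (\<Prod>j\<le>n. real (M j)) powr (2 * s - 1) * (9 ^ Suc n) powr s
      \<le> 2 powr (1 - s) * exp ((1 - s) * L * B ^ Suc n)
        * exp ((2 * s - 1) * L * ((B ^ Suc (Suc n) - B) / (B - 1))) * exp (real (Suc n) * (s * ln 9))"
      unfolding 3 using 1 2 by (intro mult_mono) auto
    also have "\<dots> = 2 powr (1 - s) * exp ((1 - s) * L * B ^ Suc n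
        + (2 * s - 1) * L * ((B ^ Suc (Suc n) - B) / (B - 1)) + real (Suc n) * (s * ln 9))"
      by (simp add: exp_add mult.assoc del: power_Suc)
    also have "(1 - s) * L * B ^ Suc n
        + (2 * s - 1) * L * ((B ^ Suc (Suc n) - B) / (B - 1)) + real (Suc n) * (s * ln 9) = e n"
    proof -
      have "(1 - s) * L * X + (2 * s - 1) * L * ((B * X - B) / (B - 1))
          = (1 - 2 * s) * L * B / (B - 1) - \<kappa> * X" for X
      proof -
        \<comment> \<open>Replacing \<open>L\<close> by \<open>W * (B - 1)\<close> clears the
          denominators and leaves a polynomial identity.\<close>
        define W where "W = L / (B - 1)"
        have "L = W * (B - 1)" using \<open>B > 1\<close> by (simp add: W_def)
        then have "(1 - s) * L * X = (1 - s) * W * (B - 1) * X" by simp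
        moreover have "(2 * s - 1) * L * ((B * X - B) / (B - 1)) = (2 * s - 1) * W * (B * X - B)"
          "(1 - 2 * s) * L * B / (B - 1) = (1 - 2 * s) * W * B" "\<kappa> = W * (1 - s * (1 + B))"
          by (simp_all add: W_def \<kappa>_def)
        ultimately show ?thesis by (simp only:) (simp add: algebra_simps)
      qed
      from this[of "B ^ Suc n"] show ?thesis by (simp add: e_def)
    qed
    finally show ?thesis .
  qed
  have "(\<lambda>n. 2 powr (1 - s) * exp (e n)) \<longlonglongrightarrow> 0"
    unfolding e_def using \<kappa> \<open>B > 1\<close> by real_asymp
  then have "Bseq (\<lambda>n. 2 powr (1 - s) * exp (e n))"
    by (rule convergentI[THEN convergent_imp_Bseq])
  then obtain C where "\<And>n. norm (2 powr (1 - s) * exp (e n)) \<le> C"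
    unfolding Bseq_def by blast
  then have "2 powr (1 - s) * exp (e n) \<le> C" for n
    unfolding real_norm_def by (rule abs_le_D1)
  then show ?thesis using bound order.trans by blast
qed

text \<open>At the first differing digit, \<open>radix_first_difference\<close> bounds the parameter
  distance from above and \<open>I_even_separation\<close> the image distance from below, both in
  terms of the digit gap \<open>k\<close> and the product \<open>P\<close>. Comparing them shows the
  inverse parametrisation to be \<open>s\<close>-Hoelder.\<close>

lemma hausdorff_measure_E_all:
  assumes "b > 1" "c > 1" "0 \<le> s" "s < 1 / (1 + b\<^sup>2)"
  shows "hausdorff_measure s (E_all b c) \<noteq> 0"
proof -
  define B where "B = b\<^sup>2"
  have B: "B > 1" using assms by (simp add: B_def)
  have s1: "s < 1" using assms(4) B by (smt (verit) B_def divide_le_eq_1)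
  define M where "M k = nat \<lceil>c powr B ^ Suc k\<rceil>" for k
  have c_powr: "c powr B ^ Suc k > 1" for k
    using assms B by (simp add: gr_one_powr del: power_Suc)
  have M_real: "real (M k) = real_of_int \<lceil>c powr B ^ Suc k\<rceil>" for k
    using c_powr[of k] by (simp add: M_def del: power_Suc)
  have M_lower: "c powr B ^ Suc k \<le> real (M k)" for k
    unfolding M_real by (rule le_of_int_ceiling)
  have M_upper: "real (M k) \<le> 2 * c powr B ^ Suc k" for k
    using c_powr[of k] of_int_ceiling_le_add_one[of "c powr B ^ Suc k"] unfolding M_real by linarith
  have M_ge: "M k \<ge> 2" for k
  proof -
    have "real (M k) > 1" using M_lower[of k] c_powr[of k] by linarith
    then show ?thesis by simp
  qed
  obtain C where C: "real (M n) powr (1 - s) * (\<Prod>j\<le>n. real (M j)) powr (2 * s - 1) * (9 ^ Suc n) powr s \<le> C" for n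
    using holder_constant_bounded[of B c s M, OF B assms(2,3) _ M_lower M_upper] assms(4)
    by (auto simp: B_def)
  \<comment> \<open>The first 2 comes from \<open>radix_first_difference\<close>, the
    \<open>2 powr s\<close> from the denominator in \<open>I_even_separation\<close>.\<close>
  define D where "D = 2 * 2 powr s * C"
  have "0 \<le> C" using C[of 0] by (rule order.trans[rotated]) simp
  then have D: "0 \<le> D" by (simp add: D_def)
  have "M k + radix_digit M k t \<ge> 1" for k t
    using M_ge[of k] by linarith
  then have "\<exists>x\<in>I_even. \<forall>k. even_digit k x = M k + radix_digit M k t" for t
    by (rule I_even_with_digits)
  then obtain h where h: "\<And>t. h t \<in> I_even" "\<And>t k. even_digit k (h t) = M k + radix_digit M k t"
    by metis
  show ?thesis
  proof (rule hausdorff_measure_nonzero_holderI[of h _ D])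
    show "h t \<in> E_all b c" for t
    proof (rule E_allI[OF h(1)])
      show "c powr (b\<^sup>2) ^ Suc k \<le> real (even_digit k (h t))" for k
        using M_lower[of k] unfolding h(2) B_def of_nat_add by linarith
    qed
    fix r t :: real assume rt: "r \<in> {0..<1}" "t \<in> {0..<1}"
    show "\<bar>r - t\<bar> \<le> D * dist (h r) (h t) powr s"
    proof (cases "r = t")
      case False
      obtain n where n: "\<forall>j<n. radix_digit M j r = radix_digit M j t"
        "radix_digit M n r \<noteq> radix_digit M n t"
        "\<bar>r - t\<bar> * (\<Prod>j\<le>n. real (M j)) \<le> 2 * \<bar>real (radix_digit M n r) - real (radix_digit M n t)\<bar>"
        using radix_first_difference[where M = M, OF rt False M_ge] by (elim exE conjE)
      define k where "k = \<bar>real (radix_digit M n r) - real (radix_digit M n t)\<bar>"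
      define P where "P = (\<Prod>j\<le>n. real (M j))"
      have M_pos: "real (M j) > 0" for j using M_ge[of j] by simp
      have P: "P > 0" unfolding P_def using M_pos by (intro prod_pos) auto
      have k1: "k \<ge> 1" using n(2) by (auto simp: k_def)
      have digit_le: "radix_digit M j u \<le> M j - 1" if "u \<in> {0..<1}" for j u
        using radix_digit_less[OF that, of M j] M_ge[of j] by simp
      have k_le: "k \<le> real (M n)"
      proof -
        have "radix_digit M n r < M n" "radix_digit M n t < M n"
          using radix_digit_less rt M_ge[of n] by simp_all
        then show ?thesis unfolding k_def by linarith
      qed
      \<comment> \<open>A digit is at most \<open>2 * M j - 1\<close>, and
        \<open>2 * M j + 1 \<le> 3 * M j\<close>.\<close>
      have digit3: "even_digit j (h u) + 2 \<le> 3 * M j" if "u \<in> {0..<1}" for j u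
        using digit_le[OF that, of j] M_ge[of j] by (simp add: h(2))
      have "k / (2 * (\<Prod>j\<le>n. 3 * real (M j))\<^sup>2) \<le> \<bar>h r - h t\<bar>"
        using I_even_separation[OF h(1) h(1), of n r t M] digit3 rt n(1,2) by (simp add: h(2) k_def)
      moreover have "2 * (\<Prod>j\<le>n. 3 * real (M j))\<^sup>2 = 2 * 9 ^ Suc n * P\<^sup>2"
      proof -
        have "(\<Prod>j\<le>n. 3 * real (M j)) = 3 ^ Suc n * P" by (simp add: prod.distrib P_def)
        moreover have "(9::real) ^ Suc n = (3 ^ Suc n)\<^sup>2"
          by (simp add: power2_eq_square flip: power_mult_distrib)
        ultimately show ?thesis by (simp add: power_mult_distrib)
      qed
      ultimately have sep: "k / (2 * 9 ^ Suc n * P\<^sup>2) \<le> dist (h r) (h t)"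
        by (simp only: dist_real_def)
      \<comment> \<open>An exact factorisation of \<open>k / P\<close> into the factor controlled by
        \<open>C\<close>, once \<open>k\<close> is replaced by \<open>M n\<close>, and the
        \<open>s\<close>-th power of the separation bound.\<close>
      have split: "k * P powr (-1) = (k powr (1 - s) * P powr (2 * s - 1) * (9 ^ Suc n) powr s)
          * (2 powr s * (k / (2 * 9 ^ Suc n * P\<^sup>2)) powr s)"
      proof -
        have sep_powr: "(k / (2 * 9 ^ Suc n * P\<^sup>2)) powr s
            = k powr s / (2 powr s * (9 ^ Suc n) powr s * P powr (2 * s))"
          using P by (simp add: powr_divide powr_mult powr_powr del: power_Suc flip: powr_numeral)
        have P_powr: "P powr (2 * s - 1) = P powr (2 * s) * P powr (-1)"
          unfolding powr_add[symmetric] by simp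
        have "(k powr (1 - s) * P powr (2 * s - 1) * (9 ^ Suc n) powr s)
            * (2 powr s * (k / (2 * 9 ^ Suc n * P\<^sup>2)) powr s)
            = (k powr (1 - s) * k powr s) * P powr (-1)"
          unfolding sep_powr P_powr using P by (simp add: mult_ac del: power_Suc)
        also have "k powr (1 - s) * k powr s = k"
          using k1 by (simp flip: powr_add)
        finally show ?thesis by (rule sym)
      qed
      have "\<bar>r - t\<bar> \<le> 2 * (k * P powr (-1))"
        using n(3) P by (simp add: k_def P_def[symmetric] powr_minus_divide pos_le_divide_eq)
      also have "\<dots> \<le> 2 * (C * (2 powr s * dist (h r) (h t) powr s))"
      proof -
        have "k powr (1 - s) * P powr (2 * s - 1) * (9 ^ Suc n) powr s
            \<le> real (M n) powr (1 - s) * P powr (2 * s - 1) * (9 ^ Suc n) powr s"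
          using k1 k_le s1 by (intro mult_right_mono powr_mono2) auto
        also have "\<dots> \<le> C" using C[of n] by (simp only: P_def)
        finally have "k powr (1 - s) * P powr (2 * s - 1) * (9 ^ Suc n) powr s \<le> C" .
        moreover have "(k / (2 * 9 ^ Suc n * P\<^sup>2)) powr s \<le> dist (h r) (h t) powr s"
          using sep k1 P \<open>0 \<le> s\<close> by (intro powr_mono2) auto
        ultimately show ?thesis
          unfolding split using \<open>0 \<le> C\<close> by (intro mult_left_mono mult_mono) auto
      qed
      finally show ?thesis by (simp add: D_def mult_ac)
    qed (use D in simp)
  qed (use assms D in auto)
qed

theorem theorem1p5:
  fixes b c :: real
  assumes "b > 1" and "c > 1"
  shows "hausdorff_dim (E_inf b c) = ereal (1 / (1 + b\<^sup>2))
       \<and> hausdorff_dim (E_all b c) = ereal (1 / (1 + b\<^sup>2))"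
proof -
  let ?d = "1 / (1 + b\<^sup>2)"
  have "hausdorff_dim (E_inf b c) \<le> ereal ?d"
    by (rule hausdorff_dim_leI) (simp_all add: hausdorff_measure_E_inf[OF assms])
  moreover have "hausdorff_dim (E_all b c) \<le> hausdorff_dim (E_inf b c)"
    by (rule hausdorff_dim_mono) (rule E_all_subset_E_inf)
  moreover have "ereal ?d \<le> hausdorff_dim (E_all b c)"
    by (rule hausdorff_dim_geI) (rule hausdorff_measure_E_all[OF assms])
  ultimately show ?thesis by (meson antisym order.trans)
qed

end
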